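(* Let $\gamma\geq 1$ and let $G$ be the Tanner graph of a variable-regular LDPC code with column weight $\gamma$. Suppose $G$ has girth at least $8$. Then there is no $(a,b)$ elementary trapping set in $G$ with $\frac{b}{a}<1$ of size $a$ less than $2\gamma-1$; that is, every $(a,b)$ elementary trapping set of $G$ with $\frac{b}{a}<1$ satisfies $a\geq 2\gamma-1$.
   Context: A Tanner graph is a finite simple bipartite graph with vertex classes $V$ (variable nodes) and $C$ (check nodes). The code is variable-regular with column weight $\gamma$ if every variable node has degree $\gamma$ in the Tanner graph. The girth is the length of a shortest cycle. For a nonempty subset $S\subseteq V$ with $|S|=a$, consider the subgraph of the Tanner graph induced by $S$ together with all check nodes adjacent to some element of $S$; if exactly $b$ of these check nodes have odd degree in this subgraph, it is called an $(a,b)$ trapping set of size $a$. It is an elementary trapping set (ETS) if every one of these check nodes has degree $1$ or $2$ in the subgraph (so $b$ is the number of degree-one check nodes). *)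

theory Defs
  imports
    Complex_Main
    "HOL-Library.Extended_Nat"
    "Graph_Theory.Graph_Theory"
begin

text \<open>
  A finite simple undirected graph is the library's \<^locale>\<open>graph\<close>: a finite symmetric digraph
  without loops and parallel arcs. Each undirected edge is a pair of opposite arcs, so the
  undirected degree of a vertex is its \<^const>\<open>out_degree\<close>.
\<close>

locale tanner_graph = graph G
  for G :: "('a, 'b) pre_digraph" and V C :: "'a set" +
  assumes verts_eq: "verts G = V \<union> C"
    and classes_disjoint: "V \<inter> C = {}"
    and bipartite: "e \<in> arcs G \<Longrightarrow>
      tail G e \<in> V \<and> head G e \<in> C \<or> tail G e \<in> C \<and> head G e \<in> V"

definition variable_regular :: "('a, 'b) pre_digraph \<Rightarrow> 'a set \<Rightarrow> nat \<Rightarrow> bool" where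
  "variable_regular G V \<gamma> \<longleftrightarrow> (\<forall>v\<in>V. out_degree G v = \<gamma>)"

text \<open>
  In a symmetric digraph, \<^const>\<open>pre_digraph.cycle\<close> also holds of an edge traversed back and forth,
  which is not a cycle of the undirected graph; hence the bound on the length.
  The girth of an acyclic graph is \<open>\<infinity>\<close>.
\<close>

definition girth :: "('a, 'b) pre_digraph \<Rightarrow> enat" where
  "girth G = (INF p \<in> {p. pre_digraph.cycle G p \<and> 3 \<le> length p}. enat (length p))"

definition adjacent_checks :: "('a, 'b) pre_digraph \<Rightarrow> 'a set \<Rightarrow> 'a set" where
  "adjacent_checks G S = {c. \<exists>v\<in>S. v \<rightarrow>\<^bsub>G\<^esub> c}"

definition trapping_subgraph :: "('a, 'b) pre_digraph \<Rightarrow> 'a set \<Rightarrow> ('a, 'b) pre_digraph" where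
  "trapping_subgraph G S = G \<restriction> (S \<union> adjacent_checks G S)"

definition trapping_set ::
    "('a, 'b) pre_digraph \<Rightarrow> 'a set \<Rightarrow> nat \<Rightarrow> nat \<Rightarrow> 'a set \<Rightarrow> bool" where
  "trapping_set G V a b S \<longleftrightarrow>
    S \<subseteq> V \<and> S \<noteq> {} \<and> card S = a \<and>
    card {c \<in> adjacent_checks G S. odd (out_degree (trapping_subgraph G S) c)} = b"

definition elementary_trapping_set ::
    "('a, 'b) pre_digraph \<Rightarrow> 'a set \<Rightarrow> nat \<Rightarrow> nat \<Rightarrow> 'a set \<Rightarrow> bool" where
  "elementary_trapping_set G V a b S \<longleftrightarrow>
    trapping_set G V a b S \<and>
    (\<forall>c \<in> adjacent_checks G S. out_degree (trapping_subgraph G S) c \<in> {1, 2})"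

end

theory Submission
  imports Defs
begin

text \<open>
  In the graph on \<open>S\<close> that joins two variable nodes with a common check, the absence of 4-cycles
  makes distinct degree-two checks distinct edges, and the absence of 6-cycles excludes triangles.
  Counting the arcs leaving \<open>S\<close> gives \<open>a * \<gamma> = b + 2 * e\<close> with \<open>e\<close> the number of edges, and Mantel's
  bound \<open>4 * e \<le> a\<^sup>2\<close> together with \<open>b < a\<close> yields \<open>2 * \<gamma> < a + 2\<close>.
\<close>

text \<open>The neighbourhood \<open>I\<close> of a vertex \<open>v0\<close> of maximum degree is
  independent, so every edge has an end in \<open>S - I\<close>. The degree sum is therefore at most
  twice the sum over \<open>S - I\<close>, where each degree is at most \<open>card I\<close>. The
  vertices in \<open>triangle_free\<close> may coincide, so that assumption also rules out loops in
  \<open>S\<close>.\<close>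

lemma mantel_degree_sum:
  fixes E :: "'a \<Rightarrow> 'a \<Rightarrow> bool"
  assumes fin: "finite S"
    and sym: "\<And>u v. E u v \<Longrightarrow> E v u"
    and triangle_free: "\<And>u v w. \<lbrakk>u \<in> S; v \<in> S; w \<in> S; E v u; E v w\<rbrakk> \<Longrightarrow> \<not> E u w"
  shows "2 * (\<Sum>v\<in>S. card {u\<in>S. E v u}) \<le> card S * card S"
proof (cases "S = {}")
  case False
  define d where "d v = card {u\<in>S. E v u}" for v
  obtain v0 where v0: "v0 \<in> S" "\<And>v. v \<in> S \<Longrightarrow> d v \<le> d v0"
  proof -
    have "Max (d ` S) \<in> d ` S" using fin False by simp
    moreover have "d v \<le> Max (d ` S)" if "v \<in> S" for v using fin that by simp
    ultimately show ?thesis using that by (metis imageE)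
  qed
  define I where "I = {u\<in>S. E v0 u}"
  have finI: "finite I" and IS: "I \<subseteq> S" and cI: "card I = d v0"
    using fin by (auto simp: I_def d_def)
  \<comment> \<open>By independence the degrees in \<open>I\<close> count only pairs between
    \<open>I\<close> and \<open>S - I\<close>; counting these pairs from the other side bounds them
    by the degrees in \<open>S - I\<close>.\<close>
  have "(\<Sum>v\<in>I. d v) = (\<Sum>v\<in>I. card {u\<in>S - I. E v u})"
  proof (rule sum.cong[OF refl])
    fix v assume "v \<in> I"
    then have "{u\<in>S. E v u} = {u\<in>S - I. E v u}"
      using triangle_free[of v v0] v0(1) by (auto simp: I_def)
    then show "d v = card {u\<in>S - I. E v u}" by (simp add: d_def)
  qed
  also have "\<dots> = (\<Sum>u\<in>S - I. card {v\<in>I. E v u})"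
    by (rule sum_multicount_gen) (use fin finI in auto)
  also have "\<dots> \<le> (\<Sum>u\<in>S - I. d u)"
    unfolding d_def by (intro sum_mono card_mono) (use fin IS sym in auto)
  finally have "(\<Sum>v\<in>S. d v) \<le> 2 * (\<Sum>u\<in>S - I. d u)"
    using sum.subset_diff[OF IS fin, of d] by simp
  also have "(\<Sum>u\<in>S - I. d u) \<le> card (S - I) * d v0"
    using sum_bounded_above[of "S - I" d "d v0"] v0(2) by simp
  finally have *: "(\<Sum>v\<in>S. d v) \<le> 2 * (card (S - I) * card I)" by (simp add: cI)
  have "card S = card (S - I) + card I"
    using card_Diff_subset[OF finI IS] card_mono[OF fin IS] by simp
  moreover have "4 * (x * y) \<le> (x + y) * (x + y)" for x y :: nat
  proof -
    \<comment> \<open>The square is taken over \<open>int\<close>, as \<open>x - y\<close> is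
      truncated on \<open>nat\<close>.\<close>
    have "0 \<le> (int x - int y)\<^sup>2" by simp
    then have "int (4 * (x * y)) \<le> int ((x + y) * (x + y))"
      by (simp add: power2_eq_square algebra_simps)
    then show ?thesis by linarith
  qed
  ultimately have "4 * (card (S - I) * card I) \<le> card S * card S" by metis
  with * show ?thesis unfolding d_def by linarith
qed simp

lemma card_filter_split:
  assumes "finite A" "\<And>x. x \<in> A \<Longrightarrow> P x \<or> Q x"
  shows "card A \<le> card {x\<in>A. P x} + card {x\<in>A. Q x}"
proof -
  have "A = {x\<in>A. P x} \<union> {x\<in>A. Q x}" using assms(2) by auto
  then show ?thesis by (metis card_Un_le)
qed

context graph
begin

lemma dominates_sym: "u \<rightarrow> v \<Longrightarrow> v \<rightarrow> u"
  by (rule graph_symmetric)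

text \<open>Without parallel arcs, \<open>head\<close> is injective on the arcs leaving
  \<open>v\<close>, so counting arcs amounts to counting neighbours.\<close>

lemma out_degree_conv_card: "out_degree G v = card {w. v \<rightarrow> w}"
proof -
  have "{w. v \<rightarrow> w} = head G ` out_arcs G v" by (force simp: arcs_ends_conv)
  moreover have "inj_on (head G) (out_arcs G v)"
    by (auto intro!: inj_onI no_multi_arcs simp: arc_to_ends_def)
  ultimately show ?thesis by (simp add: out_degree_def card_image)
qed

lemma out_degree_induce_conv_card:
  assumes "v \<in> W"
  shows "out_degree (G \<restriction> W) v = card {w\<in>W. v \<rightarrow> w}"
proof -
  have "{w\<in>W. v \<rightarrow> w} = head G ` out_arcs (G \<restriction> W) v"
    using assms by (force simp: arcs_ends_conv)
  moreover have "inj_on (head G) (out_arcs (G \<restriction> W) v)"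
    by (auto intro!: inj_onI no_multi_arcs simp: arc_to_ends_def)
  ultimately show ?thesis by (simp add: out_degree_def card_image)
qed

lemma finite_dominated: "finite {w. v \<rightarrow> w}"
  by (rule finite_subset[OF _ finite_verts]) (auto simp: arcs_ends_conv)

lemma girth_le: "cycle p \<Longrightarrow> 3 \<le> length p \<Longrightarrow> girth G \<le> enat (length p)"
  unfolding girth_def by (rule INF_lower) simp

text \<open>Cycles are lists of arcs, while the arguments below produce closed paths as vertices;
  choosing an arc for each adjacency bridges the two.\<close>

lemma girth_le_4:
  assumes "u1 \<rightarrow> u2" "u2 \<rightarrow> u3" "u3 \<rightarrow> u4" "u4 \<rightarrow> u1"
    and "distinct [u1, u2, u3, u4]"
  shows "girth G \<le> 4"
proof -
  from assms obtain e1 e2 e3 e4 where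
    "e1 \<in> arcs G" "tail G e1 = u1" "head G e1 = u2"
    "e2 \<in> arcs G" "tail G e2 = u2" "head G e2 = u3"
    "e3 \<in> arcs G" "tail G e3 = u3" "head G e3 = u4"
    "e4 \<in> arcs G" "tail G e4 = u4" "head G e4 = u1"
    by (auto simp: arcs_ends_conv)
  with assms(5) have "cycle [e1, e2, e3, e4]"
    unfolding cycle_def awalk_def by (intro exI[of _ u1]) (auto)
  from girth_le[OF this] show ?thesis by (simp add: numeral_eq_enat eval_nat_numeral)
qed

lemma girth_le_6:
  assumes "u1 \<rightarrow> u2" "u2 \<rightarrow> u3" "u3 \<rightarrow> u4" "u4 \<rightarrow> u5" "u5 \<rightarrow> u6" "u6 \<rightarrow> u1"
    and "distinct [u1, u2, u3, u4, u5, u6]"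
  shows "girth G \<le> 6"
proof -
  from assms obtain e1 e2 e3 e4 e5 e6 where
    "e1 \<in> arcs G" "tail G e1 = u1" "head G e1 = u2"
    "e2 \<in> arcs G" "tail G e2 = u2" "head G e2 = u3"
    "e3 \<in> arcs G" "tail G e3 = u3" "head G e3 = u4"
    "e4 \<in> arcs G" "tail G e4 = u4" "head G e4 = u5"
    "e5 \<in> arcs G" "tail G e5 = u5" "head G e5 = u6"
    "e6 \<in> arcs G" "tail G e6 = u6" "head G e6 = u1"
    by (auto simp: arcs_ends_conv)
  with assms(7) have "cycle [e1, e2, e3, e4, e5, e6]"
    unfolding cycle_def awalk_def by (intro exI[of _ u1]) (auto)
  from girth_le[OF this] show ?thesis by (simp add: numeral_eq_enat eval_nat_numeral)
qed

end

context tanner_graph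
begin

lemma dominates_check: "v \<in> V \<Longrightarrow> v \<rightarrow>\<^bsub>G\<^esub> c \<Longrightarrow> c \<in> C"
  using bipartite classes_disjoint by (fastforce simp: arcs_ends_conv)

lemma dominates_variable: "c \<in> C \<Longrightarrow> c \<rightarrow>\<^bsub>G\<^esub> v \<Longrightarrow> v \<in> V"
  using bipartite classes_disjoint by (fastforce simp: arcs_ends_conv)

lemma adjacent_checks_subset: "S \<subseteq> V \<Longrightarrow> adjacent_checks G S \<subseteq> C"
  using dominates_check by (auto simp: adjacent_checks_def)

lemma finite_adjacent_checks: "S \<subseteq> V \<Longrightarrow> finite (adjacent_checks G S)"
  using adjacent_checks_subset[of S] verts_eq finite_verts by (metis finite_Un finite_subset)

text \<open>All neighbours of a check are variable nodes, so the other checks kept in the induced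
  subgraph add nothing to its degree.\<close>

lemma out_degree_trapping_subgraph:
  assumes "S \<subseteq> V" "c \<in> adjacent_checks G S"
  shows "out_degree (trapping_subgraph G S) c = card {v\<in>S. v \<rightarrow>\<^bsub>G\<^esub> c}"
proof -
  have c: "c \<in> C" using assms adjacent_checks_subset by blast
  have "{w \<in> S \<union> adjacent_checks G S. c \<rightarrow>\<^bsub>G\<^esub> w} = {v\<in>S. v \<rightarrow>\<^bsub>G\<^esub> c}"
    using dominates_variable[OF c] adjacent_checks_subset[OF assms(1)] classes_disjoint
    by (auto dest: dominates_sym)
  then show ?thesis
    unfolding trapping_subgraph_def using assms(2) by (simp add: out_degree_induce_conv_card)
qed

text \<open>Otherwise \<open>u\<close>, \<open>c\<close>, \<open>v\<close>, \<open>c'\<close> would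
  form a 4-cycle.\<close>

lemma common_check_unique:
  assumes "girth G \<ge> 8" "u \<in> V" "v \<in> V" "u \<noteq> v"
    and "u \<rightarrow>\<^bsub>G\<^esub> c" "v \<rightarrow>\<^bsub>G\<^esub> c" "u \<rightarrow>\<^bsub>G\<^esub> c'" "v \<rightarrow>\<^bsub>G\<^esub> c'"
  shows "c = c'"
proof (rule ccontr)
  assume "c \<noteq> c'"
  moreover have "c \<in> C" "c' \<in> C" using assms dominates_check by blast+
  ultimately have "distinct [u, c, v, c']" using assms(2-4) classes_disjoint by auto
  from girth_le_4[OF _ _ _ _ this] have "girth G \<le> 4"
    using assms(5-8) dominates_sym by blast
  with assms(1) have "(8::enat) \<le> 4" by (rule order_trans)
  then show False by simp
qed

text \<open>Three pairwise distinct checks would close a 6-cycle. Girth alone still permits one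
  check adjacent to all three variable nodes, hence this conclusion instead of a contradiction; the
  degree bound of an elementary trapping set excludes that case later.\<close>

lemma common_check_no_triangle:
  assumes "girth G \<ge> 8" "u \<in> V" "v \<in> V" "w \<in> V" "distinct [u, v, w]"
    and "u \<rightarrow>\<^bsub>G\<^esub> c1" "v \<rightarrow>\<^bsub>G\<^esub> c1" "v \<rightarrow>\<^bsub>G\<^esub> c2" "w \<rightarrow>\<^bsub>G\<^esub> c2" "w \<rightarrow>\<^bsub>G\<^esub> c3" "u \<rightarrow>\<^bsub>G\<^esub> c3"
  shows "w \<rightarrow>\<^bsub>G\<^esub> c1"
proof (rule ccontr)
  assume "\<not> w \<rightarrow>\<^bsub>G\<^esub> c1"
  then have "c1 \<noteq> c2" "c1 \<noteq> c3" using assms by auto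
  \<comment> \<open>If \<open>c2 = c3\<close>, then \<open>u\<close> and \<open>v\<close> share both
    \<open>c1\<close> and \<open>c2\<close>, against uniqueness of the common check.\<close>
  have "c2 \<noteq> c3"
    using common_check_unique[of u v c1 c2] assms \<open>c1 \<noteq> c2\<close> by auto
  moreover have "c1 \<in> C" "c2 \<in> C" "c3 \<in> C" using assms dominates_check by blast+
  ultimately have "distinct [u, c1, v, c2, w, c3]"
    using assms(2-5) \<open>c1 \<noteq> c2\<close> \<open>c1 \<noteq> c3\<close> classes_disjoint by auto
  from girth_le_6[OF _ _ _ _ _ _ this] have "girth G \<le> 6"
    using assms(6-) dominates_sym by blast
  with assms(1) have "(8::enat) \<le> 6" by (rule order_trans)
  then show False by simp
qed

end

theorem theorem2:
  fixes G :: "('a, 'b) pre_digraph" and V C S :: "'a set" and \<gamma> a b :: nat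
  assumes "\<gamma> \<ge> 1"
    and "tanner_graph G V C"
    and "variable_regular G V \<gamma>"
    and "girth G \<ge> 8"
    and "elementary_trapping_set G V a b S"
    and "real b / real a < 1"
  shows "a \<ge> 2 * \<gamma> - 1"
proof -
  interpret tanner_graph G V C by fact
  define A where "A = adjacent_checks G S"
  define d where "d c = card {v\<in>S. v \<rightarrow>\<^bsub>G\<^esub> c}" for c
  have SV: "S \<subseteq> V" and "S \<noteq> {}" and cS: "card S = a"
    using assms(5) by (auto simp: elementary_trapping_set_def trapping_set_def)
  have finS: "finite S"
    using SV verts_eq finite_verts by (metis finite_Un finite_subset)
  \<comment> \<open>Positivity comes first: for \<open>a = 0\<close> the quotient would be 0 by the
    convention for division by zero, and \<open>b < a\<close> would fail.\<close>
  have "a > 0" using \<open>S \<noteq> {}\<close> cS finS by auto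
  then have ba: "b < a" using assms(6) by (simp add: divide_less_eq)
  have finA: "finite A" unfolding A_def by (rule finite_adjacent_checks[OF SV])
  have deg: "out_degree (trapping_subgraph G S) c = d c" if "c \<in> A" for c
    using that out_degree_trapping_subgraph[OF SV] by (simp add: A_def d_def)
  have d12: "d c = 1 \<or> d c = 2" if "c \<in> A" for c
    using assms(5) that deg[OF that] by (auto simp: elementary_trapping_set_def A_def)
  \<comment> \<open>Among the degrees 1 and 2 only 1 is odd, so \<open>b\<close> counts the
    leaves.\<close>
  have "{c\<in>A. odd (out_degree (trapping_subgraph G S) c)} = {c\<in>A. d c = 1}"
    using deg d12 by fastforce
  then have cb: "card {c\<in>A. d c = 1} = b"
    using assms(5) by (simp add: elementary_trapping_set_def trapping_set_def A_def)

  define E where "E u v \<longleftrightarrow> u \<noteq> v \<and> (\<exists>c. u \<rightarrow>\<^bsub>G\<^esub> c \<and> v \<rightarrow>\<^bsub>G\<^esub> c)" for u v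
  \<comment> \<open>The checks at \<open>v\<close> split into leaves and degree-two checks, and the
    latter inject into the \<open>E\<close>-neighbours of \<open>v\<close>. This inequality is
    enough for the final count.\<close>
  have degree: "\<gamma> \<le> card {c\<in>{c\<in>A. d c = 1}. v \<rightarrow>\<^bsub>G\<^esub> c} + card {u\<in>S. E v u}" if v: "v \<in> S" for v
  proof -
    define N where "N = {c. v \<rightarrow>\<^bsub>G\<^esub> c}"
    have NA: "N \<subseteq> A" using v by (auto simp: N_def A_def adjacent_checks_def)
    have finN: "finite N" unfolding N_def by (rule finite_dominated)
    have "\<exists>u\<in>S. u \<noteq> v \<and> u \<rightarrow>\<^bsub>G\<^esub> c" if "d c = 2" for c
    proof (rule ccontr)
      assume "\<not> ?thesis"
      then have "{u\<in>S. u \<rightarrow>\<^bsub>G\<^esub> c} \<subseteq> {v}" by auto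
      then have "d c \<le> 1" unfolding d_def using card_mono[of "{v}"] by fastforce
      then show False using that by simp
    qed
    \<comment> \<open>\<open>f\<close> sends a degree-two check at \<open>v\<close> to its other
      end. It is injective because \<open>v\<close> and \<open>f c\<close> have only one check in
      common.\<close>
    then obtain f where f: "\<And>c. d c = 2 \<Longrightarrow> f c \<in> S \<and> f c \<noteq> v \<and> f c \<rightarrow>\<^bsub>G\<^esub> c" by metis
    have "card {c\<in>N. d c = 2} \<le> card {u\<in>S. E v u}"
    proof (rule card_inj_on_le[of f])
      show "inj_on f {c\<in>N. d c = 2}"
      proof (rule inj_onI)
        fix c c' assume "c \<in> {c\<in>N. d c = 2}" "c' \<in> {c\<in>N. d c = 2}" "f c = f c'"
        then show "c = c'"
          using common_check_unique[OF assms(4), of v "f c" c c'] f[of c] f[of c'] v SV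
          by (auto simp: N_def)
      qed
      show "f ` {c\<in>N. d c = 2} \<subseteq> {u\<in>S. E v u}"
        using f by (fastforce simp: N_def E_def)
    qed (use finS in simp)
    moreover have "\<gamma> = card N"
      using assms(3) v SV by (auto simp: variable_regular_def out_degree_conv_card N_def)
    moreover have "card N \<le> card {c\<in>N. d c = 1} + card {c\<in>N. d c = 2}"
      using NA d12 by (intro card_filter_split finN) auto
    moreover have "{c\<in>N. d c = 1} = {c\<in>{c\<in>A. d c = 1}. v \<rightarrow>\<^bsub>G\<^esub> c}"
      using NA by (auto simp: N_def)
    ultimately show ?thesis by simp
  qed

  have triangle_free: "\<not> E u w" if E: "u \<in> S" "v \<in> S" "w \<in> S" "E v u" "E v w" for u v w
  proof
    assume "E u w"
    then obtain c1 c2 c3 where "u \<rightarrow>\<^bsub>G\<^esub> c1" "v \<rightarrow>\<^bsub>G\<^esub> c1" "v \<rightarrow>\<^bsub>G\<^esub> c2" "w \<rightarrow>\<^bsub>G\<^esub> c2" "w \<rightarrow>\<^bsub>G\<^esub> c3" "u \<rightarrow>\<^bsub>G\<^esub> c3"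
      using E(4,5) by (auto simp: E_def)
    moreover have dist: "distinct [u, v, w]" using that \<open>E u w\<close> by (auto simp: E_def)
    ultimately have c1: "u \<rightarrow>\<^bsub>G\<^esub> c1" "v \<rightarrow>\<^bsub>G\<^esub> c1" "w \<rightarrow>\<^bsub>G\<^esub> c1"
      using common_check_no_triangle[OF assms(4), of u v w c1 c2 c3] that SV by auto
    \<comment> \<open>One check would have three neighbours in \<open>S\<close>, but in an
      elementary trapping set it has at most two.\<close>
    then have "card {u, v, w} \<le> d c1"
      unfolding d_def using that finS by (intro card_mono) auto
    moreover have "c1 \<in> A" using c1 that(1) by (auto simp: A_def adjacent_checks_def)
    ultimately show False using d12[of c1] dist by auto
  qed

  \<comment> \<open>Double counting: each leaf check has exactly one neighbour in \<open>S\<close>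
    and contributes 1.\<close>
  have "(\<Sum>v\<in>S. card {c\<in>{c\<in>A. d c = 1}. v \<rightarrow>\<^bsub>G\<^esub> c}) = (\<Sum>c\<in>{c\<in>A. d c = 1}. 1)"
    by (rule sum_multicount_gen) (use finS finA in \<open>auto simp: d_def\<close>)
  also have "\<dots> = b" using cb by simp
  finally have leaves: "(\<Sum>v\<in>S. card {c\<in>{c\<in>A. d c = 1}. v \<rightarrow>\<^bsub>G\<^esub> c}) = b" .
  have "(\<Sum>v\<in>S. \<gamma>) \<le> (\<Sum>v\<in>S. card {c\<in>{c\<in>A. d c = 1}. v \<rightarrow>\<^bsub>G\<^esub> c} + card {u\<in>S. E v u})"
    by (rule sum_mono) (rule degree)
  then have "a * \<gamma> \<le> b + (\<Sum>v\<in>S. card {u\<in>S. E v u})"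
    unfolding sum.distrib leaves by (simp add: cS)
  moreover have "2 * (\<Sum>v\<in>S. card {u\<in>S. E v u}) \<le> a * a"
    unfolding cS[symmetric]
  proof (rule mantel_degree_sum[OF finS])
    show "E v u" if "E u v" for u v using that by (auto simp: E_def)
    show "\<not> E u w" if "u \<in> S" "v \<in> S" "w \<in> S" "E v u" "E v w" for u v w
      using that by (rule triangle_free)
  qed
  \<comment> \<open>Doubling the arc count gives 2a\<gamma> \<le> 2b + a*a, and \<open>b < a\<close>
    makes the bound strict. After cancelling \<open>a\<close>, this strictness turns 2\<gamma> < a +
    2 into the stated bound over the integers.\<close>
  ultimately have "2 * (a * \<gamma>) < 2 * a + a * a" using ba by linarith
  then have "a * (2 * \<gamma>) < a * (2 + a)" by (simp add: algebra_simps)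
  then have "2 * \<gamma> < 2 + a" by (simp only: mult_less_cancel1)
  then show ?thesis by simp
qed

end
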